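(* Consider the distributed sequential test described in the context and let $k=Nr^2$. For each $\epsilon\in(0,1/2)$ take $\alpha=\beta=\epsilon$ and choose, for all $i=1,\dots,N$, the thresholds $$\gamma_{d,i}^{h}=\frac{8(k+1)}{7N}\left(\log\left(\frac{2}{\epsilon}\right)-\log\left(1-e^{-\frac{Nm}{4(k+1)}}\right)\right),\qquad \gamma_{d,i}^{l}=\frac{8(k+1)}{7N}\left(\log\left(\frac{\epsilon}{2}\right)+\log\left(1-e^{-\frac{Nm}{4(k+1)}}\right)\right),$$ and let $T_{d,i}$ be the resulting stopping time of agent $i$ (which depends on $\epsilon$). Let $$\mathcal M(\epsilon)=\frac{(1-\epsilon)\log\left(\frac{1-\epsilon}{\epsilon}\right)+\epsilon\log\left(\frac{\epsilon}{1-\epsilon}\right)}{Nm}.$$ Then $$1\ \le\ \limsup_{\epsilon\to0}\frac{\mathbb{E}_1[T_{d,i}]}{\mathcal M(\epsilon)}\ \le\ \frac{10(k+1)}{7},\qquad\forall i=1,2,\dots,N.$$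
   Context: Observation model: there are $N$ agents; at each time $t=1,2,\dots$ agent $i$ observes $y_i(t)=\mu_\theta+n_i(t)$ under hypothesis $H_\theta$, $\theta\in\{0,1\}$, with $\mu_1=\mu$, $\mu_0=-\mu$, $\mu\neq 0$. The noises $n_i(t)$ are independent over all agents $i$ and times $t$, each Gaussian with mean $0$ and variance $\sigma^2>0$, under both hypotheses. $\mathbb{P}_\theta,\mathbb{E}_\theta$ denote probability and expectation under $H_\theta$. The log-likelihood ratio at agent $i$ is $\eta_i(t)=2\mu y_i(t)/\sigma^2$, and $\boldsymbol\eta(t)=(\eta_1(t),\dots,\eta_N(t))^\top$. Put $m=2\mu^2/\sigma^2$; thus $\eta_i(t)\sim\mathcal N(m,2m)$ under $H_1$ and $\mathcal N(-m,2m)$ under $H_0$ (mean, variance). Network: $G=(V,E)$ is a connected simple undirected graph on the agents $V=\{1,\dots,N\}$. $\mathbf W=[w_{ij}]$ is an $N\times N$ non-negative, symmetric, irreducible, stochastic (rows sum to one) matrix with $w_{ij}=0$ whenever $i\ne j$ and $(i,j)\notin E$. Let $\mathbf J=\frac1N\mathbf 1\mathbf 1^\top$ and $r=\|\mathbf W-\mathbf J\|$ (induced $\mathcal L_2$ norm), and assume $r<1$. Test: the vector of agent statistics $\mathbf S_d(t)=(S_{d,1}(t),\dots,S_{d,N}(t))^\top$ is given by $\mathbf S_d(0)=\mathbf 0$ and $\mathbf S_d(t+1)=\mathbf W(\mathbf S_d(t)+\boldsymbol\eta(t+1))$, i.e. $S_{d,i}(t)=\sum_{j=1}^t\mathbf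 e_i^\top\mathbf W^{t+1-j}\boldsymbol\eta(j)$. Given thresholds $\gamma_{d,i}^l,\gamma_{d,i}^h\in\mathbb R$, the stopping time of agent $i$ is $T_{d,i}=\inf\{t\ge1: S_{d,i}(t)\notin[\gamma_{d,i}^l,\gamma_{d,i}^h]\}$; at $T_{d,i}$ agent $i$ decides $H_0$ if $S_{d,i}(T_{d,i})\le\gamma_{d,i}^l$ and $H_1$ if $S_{d,i}(T_{d,i})\ge\gamma_{d,i}^h$. Here $\alpha$ and $\beta$ are the prescribed upper bounds on the probabilities of false alarm $\mathbb P_0(S_{d,i}(T_{d,i})\ge\gamma_{d,i}^h)$ and of miss $\mathbb P_1(S_{d,i}(T_{d,i})\le\gamma_{d,i}^l)$. The quantity $\mathcal M(\epsilon)$ is Wald's universal lower bound on the $H_1$-expected stopping time of any a.s. finite sequential test, adapted to the observations of all $N$ agents, whose false alarm and miss probabilities are both at most $\epsilon$. $\log$ is the natural logarithm. *)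

theory Defs
  imports "HOL-Probability.Probability"
begin

text \<open>The agents are the elements of a finite type \<open>'n\<close>, so that N is \<open>CARD('n)\<close>.
  A simple undirected graph on them is a symmetric irreflexive relation.\<close>

definition connected_simple_graph :: "('n \<times> 'n) set \<Rightarrow> bool" where
  "connected_simple_graph E \<longleftrightarrow> sym E \<and> irrefl E \<and> (\<forall>i j. (i, j) \<in> E\<^sup>*)"

text \<open>Reducibility means that a simultaneous permutation of rows and columns makes the matrix
  block triangular with square diagonal blocks; \<open>S\<close> is the index set of the lower block.\<close>

definition irreducible_matrix :: "real^'n^'n \<Rightarrow> bool" where
  "irreducible_matrix A \<longleftrightarrow>
     \<not> (\<exists>S. S \<noteq> {} \<and> S \<noteq> UNIV \<and> (\<forall>i\<in>S. \<forall>j\<in>-S. A $ i $ j = 0))"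

definition weight_matrix :: "('n::finite \<times> 'n) set \<Rightarrow> real^'n^'n \<Rightarrow> bool" where
  "weight_matrix E W \<longleftrightarrow>
     (\<forall>i j. 0 \<le> W $ i $ j) \<and> transpose W = W \<and> irreducible_matrix W \<and>
     (\<forall>i. (\<Sum>j\<in>UNIV. W $ i $ j) = 1) \<and>
     (\<forall>i j. i \<noteq> j \<longrightarrow> (i, j) \<notin> E \<longrightarrow> W $ i $ j = 0)"

definition averaging_matrix :: "real^'n^'n" where
  "averaging_matrix = (\<chi> i j. 1 / real CARD('n))"

definition mixing_rate :: "real^'n^'n \<Rightarrow> real" where
  "mixing_rate W = onorm ((*v) (W - averaging_matrix))"

definition hyp_mean :: "real \<Rightarrow> nat \<Rightarrow> real" where
  "hyp_mean \<mu> \<theta> = (if \<theta> = 1 then \<mu> else - \<mu>)"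

text \<open>\<open>P \<theta>\<close> is the law under the hypothesis \<open>\<theta>\<close>, and \<open>y i t\<close> is the observation of agent
  \<open>i\<close> at time \<open>t\<close>; only times \<open>t \<ge> 1\<close> are constrained.\<close>

definition gaussian_observations ::
  "(nat \<Rightarrow> 'a measure) \<Rightarrow> ('n \<Rightarrow> nat \<Rightarrow> 'a \<Rightarrow> real) \<Rightarrow> real \<Rightarrow> real \<Rightarrow> bool" where
  "gaussian_observations P y \<mu> \<sigma> \<longleftrightarrow>
     sets (P 0) = sets (P 1) \<and>
     (\<forall>\<theta>\<in>{0, 1}.
        prob_space (P \<theta>) \<and>
        prob_space.indep_vars (P \<theta>) (\<lambda>_. borel)
          (\<lambda>(i, t) \<omega>. y i t \<omega> - hyp_mean \<mu> \<theta>) (UNIV \<times> {1..}) \<and>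
        (\<forall>i. \<forall>t\<ge>1. distributed (P \<theta>) lborel
          (\<lambda>\<omega>. y i t \<omega> - hyp_mean \<mu> \<theta>) (normal_density 0 \<sigma>)))"

definition llr :: "real \<Rightarrow> real \<Rightarrow> ('n \<Rightarrow> nat \<Rightarrow> 'a \<Rightarrow> real) \<Rightarrow> 'a \<Rightarrow> nat \<Rightarrow> real^'n" where
  "llr \<mu> \<sigma> y \<omega> t = (\<chi> i. 2 * \<mu> * y i t \<omega> / \<sigma>\<^sup>2)"

primrec test_stat :: "real^'n^'n \<Rightarrow> (nat \<Rightarrow> real^'n) \<Rightarrow> nat \<Rightarrow> real^'n" where
  "test_stat W \<eta> 0 = 0"
| "test_stat W \<eta> (Suc t) = W *v (test_stat W \<eta> t + \<eta> (Suc t))"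

text \<open>The infimum is taken in \<^typ>\<open>enat\<close>, hence is \<open>\<infinity>\<close> if the path never leaves \<open>[l, h]\<close>.\<close>

definition exit_time :: "real \<Rightarrow> real \<Rightarrow> (nat \<Rightarrow> real) \<Rightarrow> enat" where
  "exit_time l h s = (INF t\<in>{t. 1 \<le> t \<and> s t \<notin> {l..h}}. enat t)"

definition agent_stopping_time ::
  "real^'n^'n \<Rightarrow> real \<Rightarrow> real \<Rightarrow> ('n \<Rightarrow> nat \<Rightarrow> 'a \<Rightarrow> real) \<Rightarrow> real \<Rightarrow> real \<Rightarrow> 'n \<Rightarrow> 'a \<Rightarrow> enat" where
  "agent_stopping_time W \<mu> \<sigma> y l h i \<omega> =
     exit_time l h (\<lambda>t. test_stat W (llr \<mu> \<sigma> y \<omega>) t $ i)"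

definition threshold_high :: "real \<Rightarrow> real \<Rightarrow> real \<Rightarrow> real \<Rightarrow> real" where
  "threshold_high N m k \<epsilon> =
     8 * (k + 1) / (7 * N) * (ln (2 / \<epsilon>) - ln (1 - exp (- (N * m / (4 * (k + 1))))))"

definition threshold_low :: "real \<Rightarrow> real \<Rightarrow> real \<Rightarrow> real \<Rightarrow> real" where
  "threshold_low N m k \<epsilon> =
     8 * (k + 1) / (7 * N) * (ln (\<epsilon> / 2) + ln (1 - exp (- (N * m / (4 * (k + 1))))))"

definition wald_bound :: "real \<Rightarrow> real \<Rightarrow> real \<Rightarrow> real" where
  "wald_bound N m \<epsilon> =
     ((1 - \<epsilon>) * ln ((1 - \<epsilon>) / \<epsilon>) + \<epsilon> * ln (\<epsilon> / (1 - \<epsilon>))) / (N * m)"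

text \<open>The expectation of an \<^typ>\<open>enat\<close>-valued time, allowed to be \<open>\<infinity>\<close>.\<close>

definition expected_time :: "'a measure \<Rightarrow> ('a \<Rightarrow> enat) \<Rightarrow> ereal" where
  "expected_time M T = enn2ereal (\<integral>\<^sup>+\<omega>. ennreal_of_enat (T \<omega>) \<partial>M)"

end

theory Submission
  imports Defs "HOL-Real_Asymp.Real_Asymp"
begin

text \<open>Under \<open>H\<^sub>1\<close> the statistic of an agent at time \<open>t\<close> is Gaussian with mean \<open>m t\<close> and, since the
  powers of \<open>W\<close> are stochastic, with variance at most \<open>2 m t\<close>. Chernoff bounds at the thresholds
  \<open>\<plusminus>h\<close> therefore show that the exit occurs after time \<open>7 h / (8 m)\<close> with probability tending to 1,
  and that the probability of not having left by time \<open>t\<close> decays geometrically after \<open>5 h / (4 m)\<close>.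
  As \<open>h / m\<close> is asymptotically \<open>8 (k + 1) / 7\<close> times Wald's bound, the two times correspond to the
  factors \<open>k + 1\<close> and \<open>10 (k + 1) / 7\<close>.\<close>

section \<open>Moment generating functions of centred Gaussians and of their independent
  sums\<close>

lemma normal_mgf:
  assumes "\<sigma> > 0" and X: "distributed M lborel X (\<lambda>x. ennreal (normal_density 0 \<sigma> x))"
  shows "(\<integral>\<^sup>+\<omega>. ennreal (exp (c * X \<omega>)) \<partial>M) = ennreal (exp (c\<^sup>2 * \<sigma>\<^sup>2 / 2))"
proof -
  \<comment> \<open>Completing the square: tilting the centred density by \<open>exp (c * x)\<close>
    moves its mean to \<open>c * \<sigma>\<^sup>2\<close>, up to the constant that becomes the
    moment generating function.\<close>
  have shift: "normal_density 0 \<sigma> x * exp (c * x)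
      = exp (c\<^sup>2 * \<sigma>\<^sup>2 / 2) * normal_density (c * \<sigma>\<^sup>2) \<sigma> x" for x
  proof -
    have "- (x - 0)\<^sup>2 / (2 * \<sigma>\<^sup>2) + c * x
        = c\<^sup>2 * \<sigma>\<^sup>2 / 2 + (- (x - c * \<sigma>\<^sup>2)\<^sup>2 / (2 * \<sigma>\<^sup>2))"
      using assms(1) by (simp add: field_simps power2_eq_square)
    then have "exp (- (x - 0)\<^sup>2 / (2 * \<sigma>\<^sup>2)) * exp (c * x)
        = exp (c\<^sup>2 * \<sigma>\<^sup>2 / 2) * exp (- (x - c * \<sigma>\<^sup>2)\<^sup>2 / (2 * \<sigma>\<^sup>2))"
      by (simp only: exp_add[symmetric])
    then show ?thesis
      by (simp add: normal_density_def)
  qed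
  have "(\<integral>\<^sup>+\<omega>. ennreal (exp (c * X \<omega>)) \<partial>M)
      = (\<integral>\<^sup>+x. ennreal (normal_density 0 \<sigma> x) * ennreal (exp (c * x)) \<partial>lborel)"
    by (rule distributed_nn_integral[OF X, symmetric]) simp
  also have "\<dots> = (\<integral>\<^sup>+x. ennreal (exp (c\<^sup>2 * \<sigma>\<^sup>2 / 2)) * ennreal (normal_density (c * \<sigma>\<^sup>2) \<sigma> x) \<partial>lborel)"
    by (simp add: ennreal_mult[symmetric] shift)
  also have "\<dots> = ennreal (exp (c\<^sup>2 * \<sigma>\<^sup>2 / 2)) * (\<integral>\<^sup>+x. ennreal (normal_density (c * \<sigma>\<^sup>2) \<sigma> x) \<partial>lborel)"
    by (rule nn_integral_cmult) simp
  also have "(\<integral>\<^sup>+x. ennreal (normal_density (c * \<sigma>\<^sup>2) \<sigma> x) \<partial>lborel) = 1"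
    using assms(1) by (subst nn_integral_eq_integral) simp_all
  finally show ?thesis by simp
qed

text \<open>Independence turns the integral of the product of exponentials into a product of
  integrals. With nonnegative integrals no integrability has to be shown.\<close>

lemma (in prob_space) indep_normal_sum_mgf:
  assumes "finite I" and "\<sigma> > 0" and ind: "indep_vars (\<lambda>_. borel) X I"
    and X: "\<And>p. p \<in> I \<Longrightarrow> distributed M lborel (X p) (\<lambda>x. ennreal (normal_density 0 \<sigma> x))"
  shows "(\<integral>\<^sup>+\<omega>. ennreal (exp (\<Sum>p\<in>I. c p * X p \<omega>)) \<partial>M)
      = ennreal (exp (\<Sum>p\<in>I. (c p)\<^sup>2 * \<sigma>\<^sup>2 / 2))"
proof -
  have "(\<integral>\<^sup>+\<omega>. ennreal (exp (\<Sum>p\<in>I. c p * X p \<omega>)) \<partial>M)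
      = (\<integral>\<^sup>+\<omega>. (\<Prod>p\<in>I. ennreal (exp (c p * X p \<omega>))) \<partial>M)"
    using assms(1) by (simp add: exp_sum prod_ennreal)
  also have "\<dots> = (\<Prod>p\<in>I. \<integral>\<^sup>+\<omega>. ennreal (exp (c p * X p \<omega>)) \<partial>M)"
    using assms(1)
    by (intro indep_vars_nn_integral
          indep_vars_compose2[OF ind, where Y = "\<lambda>p x. ennreal (exp (c p * x))"]) auto
  also have "\<dots> = (\<Prod>p\<in>I. ennreal (exp ((c p)\<^sup>2 * \<sigma>\<^sup>2 / 2)))"
    by (intro prod.cong refl normal_mgf assms)
  also have "\<dots> = ennreal (exp (\<Sum>p\<in>I. (c p)\<^sup>2 * \<sigma>\<^sup>2 / 2))"
    using assms(1) by (simp add: exp_sum prod_ennreal)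
  finally show ?thesis .
qed

section \<open>Row-stochastic matrices and their powers\<close>

definition row_stochastic :: "real^'n^'n \<Rightarrow> bool" where
  "row_stochastic A \<longleftrightarrow> (\<forall>i j. 0 \<le> A $ i $ j) \<and> (\<forall>i. (\<Sum>j\<in>UNIV. A $ i $ j) = 1)"

primrec matrix_power :: "real^'n^'n \<Rightarrow> nat \<Rightarrow> real^'n^'n" where
  "matrix_power A 0 = mat 1"
| "matrix_power A (Suc n) = A ** matrix_power A n"

lemma row_stochastic_mult:
  assumes "row_stochastic A" "row_stochastic B"
  shows "row_stochastic (A ** B)"
proof -
  have "(\<Sum>j\<in>UNIV. \<Sum>l\<in>UNIV. A $ i $ l * B $ l $ j) = 1" for i
    using assms by (subst sum.swap) (simp add: row_stochastic_def flip: sum_distrib_left)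
  then show ?thesis
    using assms by (auto simp: row_stochastic_def matrix_matrix_mult_def intro!: sum_nonneg)
qed

lemma row_stochastic_matrix_power:
  assumes "row_stochastic A"
  shows "row_stochastic (matrix_power A n)"
proof (induction n)
  case 0
  show ?case by (simp add: row_stochastic_def mat_def)
next
  case (Suc n)
  then show ?case using assms by (simp add: row_stochastic_mult)
qed

text \<open>Entries of a stochastic row lie in [0, 1], so each square is at most the entry. This
  bounds the variance contributed by one time step.\<close>

lemma row_stochastic_sum_squares_le:
  assumes "row_stochastic A"
  shows "(\<Sum>j\<in>UNIV. (A $ i $ j)\<^sup>2) \<le> 1"
proof -
  have "A $ i $ j \<le> (\<Sum>j\<in>UNIV. A $ i $ j)" for j
    using assms by (intro member_le_sum) (auto simp: row_stochastic_def)
  then have "(A $ i $ j)\<^sup>2 \<le> A $ i $ j" for j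
    using assms mult_left_mono[of "A $ i $ j" 1 "A $ i $ j"]
    by (auto simp: row_stochastic_def power2_eq_square)
  then have "(\<Sum>j\<in>UNIV. (A $ i $ j)\<^sup>2) \<le> (\<Sum>j\<in>UNIV. A $ i $ j)"
    by (rule sum_mono)
  then show ?thesis using assms by (simp add: row_stochastic_def)
qed

section \<open>The statistic as a weighted sum of log-likelihood ratios, and its exponential
  moments\<close>

lemma test_stat_eq_sum:
  "test_stat W \<eta> t = (\<Sum>j\<in>{1..t}. matrix_power W (Suc t - j) *v \<eta> j)"
proof (induction t)
  case 0
  show ?case by simp
next
  case (Suc t)
  \<comment> \<open>One more multiplication by \<open>W\<close> raises every exponent by one; the
    truncated subtraction is exact because \<open>j \<le> t\<close>. The newest term enters with
    exponent one.\<close>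
  have "(\<Sum>j\<in>{1..t}. W *v (matrix_power W (Suc t - j) *v \<eta> j))
      = (\<Sum>j\<in>{1..t}. matrix_power W (Suc (Suc t) - j) *v \<eta> j)"
    by (intro sum.cong refl) (auto simp: matrix_vector_mul_assoc Suc_diff_le)
  then show ?case
    by (simp add: Suc matrix_vector_right_distrib vec.linear_sum[OF matrix_vector_mul_linear_gen]
          matrix_vector_mul_assoc)
qed

text \<open>The sum runs over pairs of agent and time because such pairs index the independent
  noises in \<open>gaussian_observations\<close>.\<close>

lemma test_stat_nth:
  "test_stat W \<eta> t $ i
     = (\<Sum>(l, j)\<in>UNIV \<times> {1..t}. matrix_power W (Suc t - j) $ i $ l * \<eta> j $ l)"
  by (simp add: test_stat_eq_sum matrix_vector_mult_def sum.swap[of _ UNIV]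
        flip: sum.cartesian_product)

lemma gaussian_observationsD:
  assumes "gaussian_observations P y \<mu> \<sigma>"
  shows "prob_space (P 1)"
    and "prob_space.indep_vars (P 1) (\<lambda>_. borel) (\<lambda>(i, t) \<omega>. y i t \<omega> - \<mu>) (UNIV \<times> {1..})"
    and "t \<ge> 1 \<Longrightarrow> distributed (P 1) lborel (\<lambda>\<omega>. y i t \<omega> - \<mu>) (normal_density 0 \<sigma>)"
    and "t \<ge> 1 \<Longrightarrow> y i t \<in> borel_measurable (P 1)"
proof -
  show "prob_space (P 1)"
    and "prob_space.indep_vars (P 1) (\<lambda>_. borel) (\<lambda>(i, t) \<omega>. y i t \<omega> - \<mu>) (UNIV \<times> {1..})"
    and *: "t \<ge> 1 \<Longrightarrow> distributed (P 1) lborel (\<lambda>\<omega>. y i t \<omega> - \<mu>) (normal_density 0 \<sigma>)"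
    using assms by (auto simp: gaussian_observations_def hyp_mean_def)
  assume "t \<ge> 1"
  \<comment> \<open>The density is given for the centred observation, so the mean is added
    back.\<close>
  then have "(\<lambda>\<omega>. (y i t \<omega> - \<mu>) + \<mu>) \<in> borel_measurable (P 1)"
    using distributed_measurable[OF *] by (intro borel_measurable_add) auto
  then show "y i t \<in> borel_measurable (P 1)" by simp
qed

lemma test_stat_measurable:
  assumes "gaussian_observations P y \<mu> \<sigma>"
  shows "(\<lambda>\<omega>. test_stat W (llr \<mu> \<sigma> y \<omega>) t $ i) \<in> borel_measurable (P 1)"
  unfolding test_stat_nth llr_def
  using gaussian_observationsD(4)[OF assms]
  by (auto intro!: borel_measurable_sum borel_measurable_times borel_measurable_divide
        simp: case_prod_beta)

text \<open>The right-hand side is the moment generating function of a centred Gaussian of variance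
  \<open>2 * m * t\<close>. It is valid for \<open>s\<close> of either sign, which serves both
  tails.\<close>

lemma test_stat_mgf_le:
  fixes y :: "'n::finite \<Rightarrow> nat \<Rightarrow> 'a \<Rightarrow> real" and W :: "real^'n^'n" and m s :: real
  assumes "\<sigma> > 0" and obs: "gaussian_observations P y \<mu> \<sigma>" and W: "row_stochastic W"
    and m: "m = 2 * \<mu>\<^sup>2 / \<sigma>\<^sup>2"
  shows "(\<integral>\<^sup>+\<omega>. ennreal (exp (s * (test_stat W (llr \<mu> \<sigma> y \<omega>) t $ i - m * real t))) \<partial>P 1)
      \<le> ennreal (exp (s\<^sup>2 * m * real t))"
proof -
  interpret prob_space "P 1" by (rule gaussian_observationsD(1)[OF obs])
  let ?I = "UNIV \<times> {1..t} :: ('n \<times> nat) set"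
  define a where "a = (\<lambda>p :: 'n \<times> nat. matrix_power W (Suc t - snd p) $ i $ fst p)"
  define X where "X = (\<lambda>p :: 'n \<times> nat. \<lambda>\<omega>. y (fst p) (snd p) \<omega> - \<mu>)"
  define c where "c = (\<lambda>p. s * (2 * \<mu> / \<sigma>\<^sup>2) * a p)"
  note stoch = row_stochastic_matrix_power[OF W]
  have sum_a: "(\<Sum>p\<in>?I. a p) = real t"
    unfolding a_def sum.cartesian_product' using stoch
    by (subst sum.swap) (simp add: row_stochastic_def)
  have sum_a2: "(\<Sum>p\<in>?I. (a p)\<^sup>2) \<le> real t"
  proof -
    have "(\<Sum>p\<in>?I. (a p)\<^sup>2)
        = (\<Sum>j\<in>{1..t}. \<Sum>l\<in>UNIV. (matrix_power W (Suc t - j) $ i $ l)\<^sup>2)"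
      unfolding a_def sum.cartesian_product' by (subst sum.swap) simp
    also have "\<dots> \<le> (\<Sum>j\<in>{1..t}. 1)"
      by (intro sum_mono row_stochastic_sum_squares_le stoch)
    finally show ?thesis by simp
  qed
  \<comment> \<open>The weights sum to \<open>t\<close>, so \<open>m * t\<close> is spread over the
    pairs as \<open>m * a p\<close>. As \<open>m\<close> is
    \<open>2 * \<mu> / \<sigma>\<^sup>2\<close> times \<open>\<mu>\<close>, this replaces each
    observation by its noise.\<close>
  have centred: "s * (test_stat W (llr \<mu> \<sigma> y \<omega>) t $ i - m * real t) = (\<Sum>p\<in>?I. c p * X p \<omega>)" for \<omega>
  proof -
    have "test_stat W (llr \<mu> \<sigma> y \<omega>) t $ i = (\<Sum>p\<in>?I. a p * (2 * \<mu> * y (fst p) (snd p) \<omega> / \<sigma>\<^sup>2))"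
      by (simp add: test_stat_nth llr_def a_def case_prod_beta)
    also have "\<dots> - m * real t
        = (\<Sum>p\<in>?I. a p * (2 * \<mu> * y (fst p) (snd p) \<omega> / \<sigma>\<^sup>2) - m * a p)"
      by (simp only: sum_subtractf sum_a flip: sum_distrib_left)
    also have "\<dots> = (\<Sum>p\<in>?I. 2 * \<mu> / \<sigma>\<^sup>2 * a p * X p \<omega>)"
      using assms(1) by (intro sum.cong refl) (simp add: m X_def field_simps power2_eq_square)
    finally show ?thesis
      by (simp add: c_def sum_distrib_left mult_ac)
  qed
  \<comment> \<open>The constant is \<open>(2 * \<mu> / \<sigma>\<^sup>2)\<^sup>2 * \<sigma>\<^sup>2
    / 2 = m\<close>.\<close>
  have var: "(\<Sum>p\<in>?I. (c p)\<^sup>2 * \<sigma>\<^sup>2 / 2) \<le> s\<^sup>2 * m * real t"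
  proof -
    have "(\<Sum>p\<in>?I. (c p)\<^sup>2 * \<sigma>\<^sup>2 / 2) = s\<^sup>2 * m * (\<Sum>p\<in>?I. (a p)\<^sup>2)"
      unfolding sum_distrib_left using assms(1)
      by (intro sum.cong refl) (simp add: c_def m field_simps power2_eq_square)
    also have "\<dots> \<le> s\<^sup>2 * m * real t"
      by (intro mult_left_mono sum_a2) (simp add: m)
    finally show ?thesis .
  qed
  have "indep_vars (\<lambda>_. borel) X (UNIV \<times> {1..})"
    using gaussian_observationsD(2)[OF obs] by (simp add: X_def case_prod_beta')
  then have "indep_vars (\<lambda>_. borel) X ?I"
    by (rule indep_vars_subset) auto
  then have "(\<integral>\<^sup>+\<omega>. ennreal (exp (\<Sum>p\<in>?I. c p * X p \<omega>)) \<partial>P 1)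
      = ennreal (exp (\<Sum>p\<in>?I. (c p)\<^sup>2 * \<sigma>\<^sup>2 / 2))"
    using assms(1) gaussian_observationsD(3)[OF obs]
    by (intro indep_normal_sum_mgf) (auto simp: X_def)
  then show ?thesis
    using var by (simp add: centred ennreal_leI)
qed

text \<open>Markov's inequality for \<open>exp (s * (X - b))\<close>. Keeping \<open>s\<close> on
  both sides of the event avoids a case split: positive \<open>s\<close> gives the upper tail,
  negative \<open>s\<close> the lower one.\<close>

lemma chernoff_bound:
  fixes s a v b :: real
  assumes [measurable]: "X \<in> borel_measurable M"
    and mgf: "(\<integral>\<^sup>+\<omega>. ennreal (exp (s * (X \<omega> - b))) \<partial>M) \<le> ennreal (exp v)"
  shows "emeasure M {\<omega>\<in>space M. s * a \<le> s * X \<omega>} \<le> ennreal (exp (s * b + v - s * a))"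
proof -
  have "emeasure M {\<omega>\<in>space M. s * a \<le> s * X \<omega>}
      = (\<integral>\<^sup>+\<omega>. indicator {\<omega>\<in>space M. s * a \<le> s * X \<omega>} \<omega> \<partial>M)"
    by simp
  \<comment> \<open>The new integrand is \<open>exp (s * X - s * a)\<close>, which is at least 1 on
    the event.\<close>
  also have "\<dots> \<le> (\<integral>\<^sup>+\<omega>. ennreal (exp (s * b - s * a)) * ennreal (exp (s * (X \<omega> - b))) \<partial>M)"
    by (intro nn_integral_mono)
       (auto simp: indicator_def algebra_simps simp flip: ennreal_mult exp_add)
  also have "\<dots> = ennreal (exp (s * b - s * a)) * (\<integral>\<^sup>+\<omega>. ennreal (exp (s * (X \<omega> - b))) \<partial>M)"
    by (rule nn_integral_cmult) simp
  also have "\<dots> \<le> ennreal (exp (s * b - s * a)) * ennreal (exp v)"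
    by (intro mult_left_mono mgf) simp
  also have "\<dots> = ennreal (exp (s * b + v - s * a))"
    by (simp add: algebra_simps flip: ennreal_mult exp_add)
  finally show ?thesis .
qed

section \<open>Exit times: pathwise bounds and bounds in expectation\<close>

lemma exit_time_le:
  assumes "1 \<le> t" "s t \<notin> {l..h}"
  shows "exit_time l h s \<le> enat t"
  unfolding exit_time_def using assms by (intro INF_lower) auto

lemma exit_time_ge:
  assumes "\<And>t. 1 \<le> t \<Longrightarrow> t \<le> n \<Longrightarrow> s t \<in> {l..h}"
  shows "enat (Suc n) \<le> exit_time l h s"
  unfolding exit_time_def
proof (intro INF_greatest)
  fix t assume "t \<in> {t. 1 \<le> t \<and> s t \<notin> {l..h}}"
  with assms[of t] have "\<not> t \<le> n" by auto
  then show "enat (Suc n) \<le> enat t" by simp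
qed

text \<open>Before its exit the path is at most \<open>h\<close>, so the time spent from
  \<open>n\<close> until the exit is at most the number of times from \<open>n\<close> on at which
  it is at most \<open>h\<close>. Since exits count from time 1, \<open>n\<close> must be
  positive.\<close>

lemma exit_time_le_suminf:
  assumes "1 \<le> n"
  shows "ennreal_of_enat (exit_time l h s)
      \<le> of_nat n + (\<Sum>t. indicator {..h} (s (t + n)))"
proof -
  \<comment> \<open>Stated for every \<open>j\<close> rather than at the exit itself, so that an
    infinite exit time is covered by letting \<open>j\<close> grow.\<close>
  have step: "of_nat (n + j) \<le> of_nat n + (\<Sum>t. indicator {..h} (s (t + n)) :: ennreal)"
    if "enat (n + j) \<le> exit_time l h s" for j
  proof -
    have "s (t + n) \<in> {l..h}" if "t < j" for t
    proof (rule ccontr)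
      assume "s (t + n) \<notin> {l..h}"
      then have "exit_time l h s \<le> enat (t + n)"
        using assms by (intro exit_time_le) auto
      with \<open>enat (n + j) \<le> exit_time l h s\<close> have "enat (n + j) \<le> enat (t + n)"
        by (rule order_trans)
      with that show False by simp
    qed
    then have "of_nat j = (\<Sum>t<j. indicator {..h} (s (t + n)) :: ennreal)"
      by simp
    also have "\<dots> \<le> (\<Sum>t. indicator {..h} (s (t + n)))"
      by (intro sum_le_suminf) auto
    finally show ?thesis by (simp add: add_left_mono)
  qed
  show ?thesis
  proof (cases "exit_time l h s")
    case (enat u)
    show ?thesis
    proof (cases "u \<le> n")
      case True
      then have "(of_nat u :: ennreal) \<le> of_nat n" by simp
      then show ?thesis using enat by (simp add: add_increasing2)
    next
      case False
      then show ?thesis using step[of "u - n"] enat by simp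
    qed
  next
    case infinity
    have "of_nat n + (\<Sum>t. indicator {..h} (s (t + n)) :: ennreal) = \<top>"
    proof (rule ccontr)
      assume "\<not> ?thesis"
      then obtain j where "of_nat n + (\<Sum>t. indicator {..h} (s (t + n)) :: ennreal) < of_nat j"
        using ennreal_Ex_less_of_nat by (metis top.not_eq_extremum)
      also have "of_nat j \<le> (of_nat (n + j) :: ennreal)" by simp
      also have "\<dots> \<le> of_nat n + (\<Sum>t. indicator {..h} (s (t + n)))"
        using step[of j] infinity by simp
      finally show False by simp
    qed
    then show ?thesis by simp
  qed
qed

text \<open>Integrating \<open>exit_time_le_suminf\<close> leaves a series of lower tail
  probabilities, which is dominated by a geometric one once \<open>n\<close> has passed
  \<open>5 * h / (4 * m)\<close>.\<close>

lemma nn_integral_exit_time_le: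
  fixes m h :: real
  assumes "prob_space M" and "m > 0" and "h > 0"
    and [measurable]: "\<And>t. S t \<in> borel_measurable M"
    and tail: "\<And>s a t. emeasure M {\<omega>\<in>space M. s * a \<le> s * S t \<omega>}
      \<le> ennreal (exp (s * (m * real t) + s\<^sup>2 * m * real t - s * a))"
  shows "(\<integral>\<^sup>+\<omega>. ennreal_of_enat (exit_time l h (\<lambda>t. S t \<omega>)) \<partial>M)
      \<le> ennreal (5 * h / (4 * m) + (1 + 1 / (1 - exp (- (4 * m / 25)))))"
proof -
  interpret prob_space M by fact
  \<comment> \<open>With parameter \<open>- u\<close> the Chernoff exponent at time \<open>t\<close>
    is \<open>u * h - (u - u\<^sup>2) * m * t\<close>, which vanishes at
    \<open>h / ((1 - u) * m)\<close>. The choice \<open>u = 1/5\<close> gives the factor 5/4.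
    Rounding \<open>x\<close> up costs at most 1.\<close>
  define x where "x = 5 * h / (4 * m)"
  define n where "n = nat \<lceil>x\<rceil>"
  have "x > 0" using assms by (simp add: x_def)
  then have n: "1 \<le> n" "x \<le> real n" "real n \<le> x + 1"
    unfolding n_def by linarith+
  define q where "q = exp (- (4 * m / 25))"
  have q: "0 < q" "q < 1" using assms by (auto simp: q_def)
  have term_le: "emeasure M {\<omega>\<in>space M. S (t + n) \<omega> \<le> h} \<le> ennreal (q ^ t)" for t
  proof -
    have "emeasure M {\<omega>\<in>space M. S (t + n) \<omega> \<le> h}
        = emeasure M {\<omega>\<in>space M. (-1/5) * h \<le> (-1/5) * S (t + n) \<omega>}"
      by (intro arg_cong[where f = "emeasure M"]) auto
    also have "\<dots> \<le> ennreal (exp ((-1/5) * (m * real (t + n)) + (-1/5)\<^sup>2 * m * real (t + n) - (-1/5) * h))"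
      by (rule tail)
    also have "(-1/5) * (m * real (t + n)) + (-1/5)\<^sup>2 * m * real (t + n) - (-1/5) * h
        = - (4 * m / 25) * (real t + (real n - x))"
      using assms by (simp add: x_def field_simps power2_eq_square)
    \<comment> \<open>Dropping \<open>real n - x\<close>, which is nonnegative, leaves a purely
      geometric term.\<close>
    also have "\<dots> \<le> - (4 * m / 25) * real t"
      using n assms by (intro mult_left_mono_neg) auto
    also have "exp (- (4 * m / 25) * real t) = q ^ t"
      by (simp add: q_def mult.commute flip: exp_of_nat_mult)
    finally show ?thesis by (simp add: ennreal_leI)
  qed
  have "(\<integral>\<^sup>+\<omega>. ennreal_of_enat (exit_time l h (\<lambda>t. S t \<omega>)) \<partial>M)
      \<le> (\<integral>\<^sup>+\<omega>. of_nat n + (\<Sum>t. indicator {..h} (S (t + n) \<omega>)) \<partial>M)"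
    by (intro nn_integral_mono exit_time_le_suminf n)
  also have "\<dots> = of_nat n + (\<Sum>t. \<integral>\<^sup>+\<omega>. indicator {..h} (S (t + n) \<omega>) \<partial>M)"
    by (simp add: nn_integral_add nn_integral_suminf emeasure_space_1)
  also have "(\<lambda>t. \<integral>\<^sup>+\<omega>. indicator {..h} (S (t + n) \<omega>) \<partial>M)
      = (\<lambda>t. emeasure M {\<omega>\<in>space M. S (t + n) \<omega> \<le> h})"
    by (auto simp: indicator_def of_bool_def simp flip: nn_integral_indicator intro!: ext nn_integral_cong)
  also have "(\<Sum>t. emeasure M {\<omega>\<in>space M. S (t + n) \<omega> \<le> h}) \<le> (\<Sum>t. ennreal (q ^ t))"
    by (intro suminf_le term_le) auto
  also have "\<dots> = ennreal (1 / (1 - q))"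
    using q by (subst suminf_ennreal2) (auto simp: suminf_geometric)
  also have "of_nat n + ennreal (1 / (1 - q)) = ennreal (real n + 1 / (1 - q))"
    using q by (simp add: ennreal_of_nat_eq_real_of_nat)
  also have "\<dots> \<le> ennreal (x + (1 + 1 / (1 - q)))"
    using n by (intro ennreal_leI) simp
  finally show ?thesis by (simp add: x_def q_def add_left_mono)
qed

text \<open>A union bound over the at most \<open>x\<close> times up to \<open>n\<close> shows that
  the path is still inside with probability at least \<open>1 - x * e\<close>, and then the exit
  time is at least \<open>x\<close>. If the bound is negative, \<open>ennreal\<close> makes it
  0.\<close>

lemma nn_integral_exit_time_ge:
  fixes m h :: real
  assumes "prob_space M" and "m > 0" and "h > 0"
    and [measurable]: "\<And>t. S t \<in> borel_measurable M"
    and tail: "\<And>s a t. emeasure M {\<omega>\<in>space M. s * a \<le> s * S t \<omega>}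
      \<le> ennreal (exp (s * (m * real t) + s\<^sup>2 * m * real t - s * a))"
  defines "x \<equiv> 7 * h / (8 * m)"
  shows "ennreal (x * (1 - x * (exp (- (h / 224)) + exp (- h))))
      \<le> (\<integral>\<^sup>+\<omega>. ennreal_of_enat (exit_time (- h) h (\<lambda>t. S t \<omega>)) \<partial>M)"
proof -
  interpret prob_space M by fact
  \<comment> \<open>Rounding down loses nothing, because staying inside up to \<open>n\<close>
    forces an exit time of at least \<open>Suc n\<close>, hence at least \<open>x\<close>.\<close>
  define n where "n = nat \<lfloor>x\<rfloor>"
  have "x > 0" using assms by (simp add: x_def)
  then have n: "real n \<le> x" "x \<le> real (Suc n)"
    unfolding n_def by linarith+
  define e where "e = exp (- (h / 224)) + exp (- h)"
  define B where "B = (\<lambda>t. {\<omega>\<in>space M. S t \<omega> \<notin> {- h..h}})"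
  have [measurable]: "B t \<in> sets M" for t
    unfolding B_def by measurable
  have B_le: "prob (B t) \<le> e" if "t \<le> n" for t
  proof -
    have tx: "m * real t \<le> 7 * h / 8"
    proof -
      have "real t \<le> x" using that n by linarith
      then show ?thesis using assms by (simp add: x_def field_simps)
    qed
    \<comment> \<open>The exponent \<open>(s + s\<^sup>2) * m * t - s * h\<close> at
      \<open>m * t = 7 * h / 8\<close> is least for \<open>s = 1/14\<close>, with value
      \<open>- h / 224\<close>.\<close>
    have up: "emeasure M {\<omega>\<in>space M. (1/14) * h \<le> (1/14) * S t \<omega>} \<le> ennreal (exp (- (h / 224)))"
      by (rule order_trans[OF tail]) (use tx in \<open>simp add: ennreal_leI power2_eq_square\<close>)
    \<comment> \<open>At \<open>s = -1\<close> drift and variance terms cancel, leaving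
      \<open>- h\<close> at every time.\<close>
    have low: "emeasure M {\<omega>\<in>space M. (-1) * (-h) \<le> (-1) * S t \<omega>} \<le> ennreal (exp (- h))"
      by (rule order_trans[OF tail]) simp
    have "emeasure M (B t) \<le> emeasure M ({\<omega>\<in>space M. (1/14) * h \<le> (1/14) * S t \<omega>}
        \<union> {\<omega>\<in>space M. (-1) * (-h) \<le> (-1) * S t \<omega>})"
      by (intro emeasure_mono) (auto simp: B_def)
    also have "\<dots> \<le> emeasure M {\<omega>\<in>space M. (1/14) * h \<le> (1/14) * S t \<omega>}
        + emeasure M {\<omega>\<in>space M. (-1) * (-h) \<le> (-1) * S t \<omega>}"
      by (intro emeasure_subadditive) measurable
    also have "\<dots> \<le> ennreal (exp (- (h / 224))) + ennreal (exp (- h))"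
      by (intro add_mono up low)
    also have "\<dots> = ennreal e" by (simp add: e_def)
    finally have "ennreal (prob (B t)) \<le> ennreal e" by (simp only: emeasure_eq_measure)
    moreover have "e \<ge> 0" by (simp add: e_def)
    ultimately show ?thesis by (simp only: ennreal_le_iff)
  qed
  define A where "A = space M - (\<Union>t\<in>{1..n}. B t)"
  have [measurable]: "A \<in> sets M" unfolding A_def by measurable
  have "prob (\<Union>t\<in>{1..n}. B t) \<le> (\<Sum>t\<in>{1..n}. prob (B t))"
    by (intro finite_measure_subadditive_finite) auto
  also have "\<dots> \<le> (\<Sum>t\<in>{1..n}. e)" by (intro sum_mono B_le) simp
  also have "\<dots> \<le> x * e" using n by (simp add: e_def mult_right_mono)
  finally have "1 - x * e \<le> prob A"
    unfolding A_def by (subst prob_compl) auto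
  then have "ennreal (x * (1 - x * e)) \<le> ennreal (x * prob A)"
    using \<open>x > 0\<close> by (intro ennreal_leI mult_left_mono) auto
  also have "\<dots> = (\<integral>\<^sup>+\<omega>. ennreal x * indicator A \<omega> \<partial>M)"
    using \<open>x > 0\<close> by (simp add: nn_integral_cmult_indicator emeasure_eq_measure ennreal_mult)
  also have "\<dots> \<le> (\<integral>\<^sup>+\<omega>. ennreal_of_enat (exit_time (- h) h (\<lambda>t. S t \<omega>)) \<partial>M)"
  proof (intro nn_integral_mono)
    fix \<omega> assume "\<omega> \<in> space M"
    show "ennreal x * indicator A \<omega> \<le> ennreal_of_enat (exit_time (- h) h (\<lambda>t. S t \<omega>))"
    proof (cases "\<omega> \<in> A")
      case True
      then have "enat (Suc n) \<le> exit_time (- h) h (\<lambda>t. S t \<omega>)"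
        by (intro exit_time_ge) (auto simp: A_def B_def)
      then have "ennreal_of_enat (enat (Suc n)) \<le> ennreal_of_enat (exit_time (- h) h (\<lambda>t. S t \<omega>))"
        by (simp only: ennreal_of_enat_le_iff)
      moreover have "ennreal x \<le> ennreal_of_enat (enat (Suc n))"
        using n by (simp add: ennreal_of_nat_eq_real_of_nat ennreal_leI del: of_nat_Suc)
      ultimately show ?thesis using True by simp
    qed simp
  qed
  finally show ?thesis by (simp add: e_def)
qed

section \<open>Asymptotics of the thresholds and of Wald's bound\<close>

lemma wald_bound_pos:
  assumes "N > 0" "m > 0" "0 < \<epsilon>" "\<epsilon> < 1/2"
  shows "wald_bound N m \<epsilon> > 0"
proof -
  have "(1 - \<epsilon>) * ln ((1 - \<epsilon>) / \<epsilon>) + \<epsilon> * ln (\<epsilon> / (1 - \<epsilon>)) = (1 - 2 * \<epsilon>) * ln ((1 - \<epsilon>) / \<epsilon>)"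
    using assms by (simp add: ln_div algebra_simps)
  moreover have "ln ((1 - \<epsilon>) / \<epsilon>) > 0" using assms by (simp add: field_simps)
  ultimately show ?thesis using assms by (simp add: wald_bound_def)
qed

text \<open>Since \<open>ln (\<epsilon> / 2) = - ln (2 / \<epsilon>)\<close>, the continuation
  interval is symmetric, as \<open>nn_integral_exit_time_ge\<close> requires.\<close>

lemma threshold_low_eq:
  assumes "0 < \<epsilon>"
  shows "threshold_low N m k \<epsilon> = - threshold_high N m k \<epsilon>"
  using assms by (simp add: threshold_low_def threshold_high_def ln_div algebra_simps)

lemma threshold_high_pos:
  assumes "N > 0" "m > 0" "k \<ge> 0" "0 < \<epsilon>" "\<epsilon> < 1/2"
  shows "threshold_high N m k \<epsilon> > 0"
proof -
  have "ln (1 - exp (- (N * m / (4 * (k + 1))))) \<le> 0"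
    using assms by (intro ln_le_zero_iff[THEN iffD2]) auto
  moreover have "ln (2 / \<epsilon>) > 0" using assms by simp
  ultimately have "ln (2 / \<epsilon>) - ln (1 - exp (- (N * m / (4 * (k + 1))))) > 0" by linarith
  then show ?thesis
    unfolding threshold_high_def using assms by (intro mult_pos_pos[of "8 * (k + 1) / (7 * N)"]) auto
qed

text \<open>Threshold and Wald bound both grow like \<open>ln (1 / \<epsilon>)\<close>, with
  coefficients \<open>8 * (k + 1) / (7 * N)\<close> and \<open>1 / (N * m)\<close>; additive
  constants disappear. The factor \<open>a\<close> is 5/4 for the upper and 7/8 for the lower
  bound.\<close>

lemma threshold_wald_ratio_tendsto:
  fixes N m k a K :: real
  assumes "N > 0" "m > 0" "k \<ge> 0" "a > 0"
  shows "((\<lambda>\<epsilon>. (a * threshold_high N m k \<epsilon> / m + K) / wald_bound N m \<epsilon>)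
           \<longlongrightarrow> a * (8 * (k + 1) / 7)) (at_right 0)"
proof -
  define c where "c = 8 * (k + 1) / (7 * N)"
  define C where "C = ln (1 - exp (- (N * m / (4 * (k + 1)))))"
  have "c > 0" using assms by (simp add: c_def)
  then have "((\<lambda>\<epsilon>. (a * (c * (ln (2 / \<epsilon>) - C)) / m + K) /
      (((1 - \<epsilon>) * ln ((1 - \<epsilon>) / \<epsilon>) + \<epsilon> * ln (\<epsilon> / (1 - \<epsilon>))) / (N * m))) \<longlongrightarrow> a * (c * N)) (at_right 0)"
    using assms by real_asymp
  moreover have "c * N = 8 * (k + 1) / 7" using assms by (simp add: c_def)
  ultimately show ?thesis
    by (simp only: threshold_high_def wald_bound_def c_def C_def)
qed

lemma threshold_high_at_top:
  fixes N m k :: real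
  assumes "N > 0" "m > 0" "k \<ge> 0"
  shows "filterlim (threshold_high N m k) at_top (at_right 0)"
proof -
  define c where "c = 8 * (k + 1) / (7 * N)"
  define C where "C = ln (1 - exp (- (N * m / (4 * (k + 1)))))"
  have "c > 0" using assms by (simp add: c_def)
  then have "filterlim (\<lambda>\<epsilon>. c * (ln (2 / \<epsilon>) - C)) at_top (at_right 0)"
    by real_asymp
  then show ?thesis
    by (simp add: threshold_high_def[abs_def] c_def C_def)
qed

text \<open>Exponential decay beats the linear number of times in the union bound.\<close>

lemma correction_tendsto_1:
  assumes "(m::real) > 0"
  shows "((\<lambda>h::real. 1 - 7 * h / (8 * m) * (exp (- (h / 224)) + exp (- h))) \<longlongrightarrow> 1) at_top"
  using assms by real_asymp

theorem theorem4p8: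
  fixes P :: "nat \<Rightarrow> 'a measure"
    and y :: "'n::finite \<Rightarrow> nat \<Rightarrow> 'a \<Rightarrow> real"
    and E :: "('n \<times> 'n) set"
    and W :: "real^'n^'n"
    and \<mu> \<sigma> N m r k :: real
    and T :: "real \<Rightarrow> 'n \<Rightarrow> 'a \<Rightarrow> enat"
  assumes "\<mu> \<noteq> 0" and "\<sigma> > 0"
    and "gaussian_observations P y \<mu> \<sigma>"
    and "connected_simple_graph E"
    and "weight_matrix E W"
    and "N = real CARD('n)"
    and "m = 2 * \<mu>\<^sup>2 / \<sigma>\<^sup>2"
    and "r = mixing_rate W"
    and "r < 1"
    and "k = N * r\<^sup>2"
    and "\<And>\<epsilon> i \<omega>. 0 < \<epsilon> \<Longrightarrow> \<epsilon> < 1/2 \<Longrightarrow>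
           T \<epsilon> i \<omega> = agent_stopping_time W \<mu> \<sigma> y
             (threshold_low N m k \<epsilon>) (threshold_high N m k \<epsilon>) i \<omega>"
  shows "\<forall>i. 1 \<le> Limsup (at_right 0) (\<lambda>\<epsilon>. expected_time (P 1) (T \<epsilon> i) / ereal (wald_bound N m \<epsilon>))
           \<and> Limsup (at_right 0) (\<lambda>\<epsilon>. expected_time (P 1) (T \<epsilon> i) / ereal (wald_bound N m \<epsilon>))
               \<le> ereal (10 * (k + 1) / 7)"
proof
  fix i
  define S where "S = (\<lambda>t \<omega>. test_stat W (llr \<mu> \<sigma> y \<omega>) t $ i)"
  define h where "h = threshold_high N m k"
  define w where "w = wald_bound N m"
  define x where "x = (\<lambda>\<epsilon>. 7 * h \<epsilon> / (8 * m))"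
  define K where "K = 1 + 1 / (1 - exp (- (4 * m / 25)))"
  define u where "u = (\<lambda>\<epsilon>. 5 * h \<epsilon> / (4 * m) + K)"
  define v where "v = (\<lambda>\<epsilon>. x \<epsilon> * (1 - x \<epsilon> * (exp (- (h \<epsilon> / 224)) + exp (- h \<epsilon>))))"
  have pos: "N > 0" "m > 0" "k \<ge> 0"
    using assms by (auto simp: zero_less_divide_iff)
  have "row_stochastic W"
    using \<open>weight_matrix E W\<close> by (simp add: weight_matrix_def row_stochastic_def)
  have meas: "S t \<in> borel_measurable (P 1)" for t
    unfolding S_def by (rule test_stat_measurable[OF \<open>gaussian_observations P y \<mu> \<sigma>\<close>])
  \<comment> \<open>Chernoff's bound with centre \<open>m * t\<close> and log-moment bound
    \<open>s\<^sup>2 * m * t\<close>.\<close>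
  have tail: "emeasure (P 1) {\<omega>\<in>space (P 1). s * a \<le> s * S t \<omega>}
      \<le> ennreal (exp (s * (m * real t) + s\<^sup>2 * m * real t - s * a))" for s a t
    by (rule chernoff_bound[OF meas], unfold S_def, rule test_stat_mgf_le) fact+
  note prob = gaussian_observationsD(1)[OF \<open>gaussian_observations P y \<mu> \<sigma>\<close>]
  have "exp (- (4 * m / 25)) < 1" using pos by simp
  then have "K > 0" by (simp add: K_def add_pos_pos)
  have small: "eventually (\<lambda>\<epsilon>::real. 0 < \<epsilon> \<and> \<epsilon> < 1/2) (at_right 0)"
    by (rule eventually_at_rightI[of 0 "1/2"]) auto
  have T_eq: "expected_time (P 1) (T \<epsilon> i)
      = enn2ereal (\<integral>\<^sup>+\<omega>. ennreal_of_enat (exit_time (- h \<epsilon>) (h \<epsilon>) (\<lambda>t. S t \<omega>)) \<partial>P 1)"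
    if "0 < \<epsilon>" "\<epsilon> < 1/2" for \<epsilon>
    using that assms(11)[OF that]
    by (simp add: expected_time_def agent_stopping_time_def threshold_low_eq h_def S_def)
  have upper: "expected_time (P 1) (T \<epsilon> i) / ereal (w \<epsilon>) \<le> ereal (u \<epsilon> / w \<epsilon>)"
    and lower: "ereal (v \<epsilon> / w \<epsilon>) \<le> expected_time (P 1) (T \<epsilon> i) / ereal (w \<epsilon>)"
    if \<epsilon>: "0 < \<epsilon>" "\<epsilon> < 1/2" for \<epsilon>
  proof -
    have h: "h \<epsilon> > 0" and w: "w \<epsilon> > 0"
      unfolding h_def w_def using pos \<epsilon> by (auto intro!: threshold_high_pos wald_bound_pos)
    have "u \<epsilon> \<ge> 0"
      unfolding u_def using h pos \<open>K > 0\<close> by simp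
    then have "expected_time (P 1) (T \<epsilon> i) \<le> ereal (u \<epsilon>)"
      using nn_integral_exit_time_le[OF prob \<open>m > 0\<close> h meas tail, of "- h \<epsilon>"]
      unfolding T_eq[OF \<epsilon>] K_def[symmetric] less_eq_ennreal.rep_eq
      by (simp add: u_def enn2ereal_ennreal)
    then have "expected_time (P 1) (T \<epsilon> i) / ereal (w \<epsilon>) \<le> ereal (u \<epsilon>) / ereal (w \<epsilon>)"
      using w by (intro ereal_divide_right_mono) auto
    then show "expected_time (P 1) (T \<epsilon> i) / ereal (w \<epsilon>) \<le> ereal (u \<epsilon> / w \<epsilon>)"
      using w by simp
    \<comment> \<open>\<open>v \<epsilon>\<close> may be negative; truncation at 0 can only enlarge
      it.\<close>
    have "ereal (v \<epsilon>) \<le> enn2ereal (ennreal (v \<epsilon>))"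
      by (cases "v \<epsilon> \<ge> 0") (auto simp: enn2ereal_ennreal ennreal_neg zero_ennreal.rep_eq)
    also have "\<dots> \<le> expected_time (P 1) (T \<epsilon> i)"
      using nn_integral_exit_time_ge[OF prob \<open>m > 0\<close> h meas tail]
      unfolding T_eq[OF \<epsilon>] v_def x_def less_eq_ennreal.rep_eq .
    finally have "ereal (v \<epsilon>) / ereal (w \<epsilon>) \<le> expected_time (P 1) (T \<epsilon> i) / ereal (w \<epsilon>)"
      using w by (intro ereal_divide_right_mono) auto
    then show "ereal (v \<epsilon> / w \<epsilon>) \<le> expected_time (P 1) (T \<epsilon> i) / ereal (w \<epsilon>)"
      using w by simp
  qed
  have "((\<lambda>\<epsilon>. u \<epsilon> / w \<epsilon>) \<longlongrightarrow> 5/4 * (8 * (k + 1) / 7)) (at_right 0)"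
    using threshold_wald_ratio_tendsto[OF pos, of "5/4" K]
    by (simp add: u_def h_def w_def mult.commute)
  also have "5/4 * (8 * (k + 1) / 7) = 10 * (k + 1) / 7" by simp
  finally have "Limsup (at_right 0) (\<lambda>\<epsilon>. ereal (u \<epsilon> / w \<epsilon>)) = ereal (10 * (k + 1) / 7)"
    by (intro lim_imp_Limsup tendsto_ereal) auto
  moreover have "Limsup (at_right 0) (\<lambda>\<epsilon>. expected_time (P 1) (T \<epsilon> i) / ereal (w \<epsilon>))
      \<le> Limsup (at_right 0) (\<lambda>\<epsilon>. ereal (u \<epsilon> / w \<epsilon>))"
    using small by (intro Limsup_mono) (blast intro: eventually_mono upper)
  ultimately have U: "Limsup (at_right 0) (\<lambda>\<epsilon>. expected_time (P 1) (T \<epsilon> i) / ereal (w \<epsilon>))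
      \<le> ereal (10 * (k + 1) / 7)"
    by simp
  \<comment> \<open>The main ratio tends to \<open>7/8 * (8 * (k + 1) / 7) = k + 1\<close>, and the
    union bound correction to 1.\<close>
  have "((\<lambda>\<epsilon>. x \<epsilon> / w \<epsilon> * (1 - x \<epsilon> * (exp (- (h \<epsilon> / 224)) + exp (- h \<epsilon>)))) \<longlongrightarrow> (k + 1) * 1)
      (at_right 0)"
  proof (intro tendsto_mult)
    have "((\<lambda>\<epsilon>. x \<epsilon> / w \<epsilon>) \<longlongrightarrow> 7/8 * (8 * (k + 1) / 7)) (at_right 0)"
      using threshold_wald_ratio_tendsto[OF pos, of "7/8" 0]
      by (simp add: x_def h_def w_def mult.commute)
    also have "7/8 * (8 * (k + 1) / 7) = k + 1" by simp
    finally show "((\<lambda>\<epsilon>. x \<epsilon> / w \<epsilon>) \<longlongrightarrow> k + 1) (at_right 0)" .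
    show "((\<lambda>\<epsilon>. 1 - x \<epsilon> * (exp (- (h \<epsilon> / 224)) + exp (- h \<epsilon>))) \<longlongrightarrow> 1) (at_right 0)"
      unfolding x_def h_def
      by (rule filterlim_compose[OF correction_tendsto_1[OF \<open>m > 0\<close>] threshold_high_at_top[OF pos]])
  qed
  then have "((\<lambda>\<epsilon>. v \<epsilon> / w \<epsilon>) \<longlongrightarrow> k + 1) (at_right 0)"
    by (simp add: v_def)
  then have "Limsup (at_right 0) (\<lambda>\<epsilon>. ereal (v \<epsilon> / w \<epsilon>)) = ereal (k + 1)"
    by (intro lim_imp_Limsup tendsto_ereal) auto
  moreover have "Limsup (at_right 0) (\<lambda>\<epsilon>. ereal (v \<epsilon> / w \<epsilon>))
      \<le> Limsup (at_right 0) (\<lambda>\<epsilon>. expected_time (P 1) (T \<epsilon> i) / ereal (w \<epsilon>))"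
    using small by (intro Limsup_mono) (blast intro: eventually_mono lower)
  \<comment> \<open>The lower estimate obtained is \<open>k + 1\<close>, and
    \<open>k = N * r\<^sup>2\<close> is nonnegative.\<close>
  moreover have "1 \<le> ereal (k + 1)" using pos by simp
  ultimately have "1 \<le> Limsup (at_right 0) (\<lambda>\<epsilon>. expected_time (P 1) (T \<epsilon> i) / ereal (w \<epsilon>))"
    by (metis order_trans)
  with U show "1 \<le> Limsup (at_right 0) (\<lambda>\<epsilon>. expected_time (P 1) (T \<epsilon> i) / ereal (wald_bound N m \<epsilon>))
           \<and> Limsup (at_right 0) (\<lambda>\<epsilon>. expected_time (P 1) (T \<epsilon> i) / ereal (wald_bound N m \<epsilon>))
               \<le> ereal (10 * (k + 1) / 7)"
    by (simp add: w_def)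
qed

end
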